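(* Let $m\ge1$ be an integer and let $(T_t)_{t\ge0}$ be an $m$-isometric semigroup on a complex Hilbert space $\mathcal H$, with generator $A$. Then the quadratic forms $(\alpha_j^A)_{j=0}^{m-1}$, densely defined by $$\alpha_j^A(y)=\sum_{i=0}^j\binom ji\langle A^iy,A^{j-i}y\rangle,\quad y\in D(A^j),$$ are bounded. Moreover (denoting the bounded extension of $\alpha_j^A$ to $\mathcal H$ by the same symbol), $$\|T_tx\|^2=\sum_{j=0}^{m-1}\frac{t^j}{j!}\alpha_j^A(x),\quad x\in\mathcal H,\ t\ge0.$$
   Context: A bounded operator $T$ on $\mathcal H$ is $m$-isometric if $\sum_{k=0}^m(-1)^{m-k}\binom mk\|T^kx\|^2=0$ for all $x\in\mathcal H$. An $m$-isometric semigroup is a $C_0$-semigroup $(T_t)_{t\ge0}$ such that each $T_t$ is $m$-isometric. In particular $\alpha_0^A(y)=\|y\|^2$. A quadratic form $\alpha$ on a dense subspace is bounded if $|\alpha(y)|\le C\|y\|^2$ for some constant $C$ and all $y$ in the subspace; it then extends uniquely by continuity to $\mathcal H$. *)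

theory Defs
  imports "HOL-Analysis.Analysis"
begin

section \<open>Complex Hilbert spaces\<close>

text \<open>
  The real inner product of the underlying real space is the real part of \<open>cinner\<close>,
  so positive definiteness, \<open>norm x = sqrt (Re (cinner x x))\<close> and the topology
  are inherited from \<^class>\<open>real_inner\<close>. The product is linear in its first argument.
\<close>

class scaleC =
  fixes scaleC :: "complex \<Rightarrow> 'a \<Rightarrow> 'a" (infixr "*\<^sub>C" 75)

class complex_inner = real_inner + scaleC +
  fixes cinner :: "'a \<Rightarrow> 'a \<Rightarrow> complex"
  assumes scaleC_add_right: "a *\<^sub>C (x + y) = a *\<^sub>C x + a *\<^sub>C y"
    and scaleC_add_left: "(a + b) *\<^sub>C x = a *\<^sub>C x + b *\<^sub>C x"
    and scaleC_scaleC: "a *\<^sub>C b *\<^sub>C x = (a * b) *\<^sub>C x"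
    and scaleC_of_real: "complex_of_real r *\<^sub>C x = r *\<^sub>R x"
    and cinner_commute: "cinner x y = cnj (cinner y x)"
    and cinner_add_left: "cinner (x + y) z = cinner x z + cinner y z"
    and cinner_scaleC_left: "cinner (a *\<^sub>C x) y = a * cinner x y"
    and Re_cinner: "Re (cinner x y) = inner x y"

class complex_hilbert = complex_inner + complete_space

instantiation complex :: complex_hilbert
begin

definition scaleC_complex :: "complex \<Rightarrow> complex \<Rightarrow> complex" where
  "scaleC_complex a x = a * x"

definition cinner_complex :: "complex \<Rightarrow> complex \<Rightarrow> complex" where
  "cinner_complex x y = x * cnj y"

instance
  by standard
    (auto simp: scaleC_complex_def cinner_complex_def algebra_simps scaleR_conv_of_real
      inner_complex_def)

end

definition csubspace :: "'a::complex_inner set \<Rightarrow> bool" where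
  "csubspace D \<longleftrightarrow> 0 \<in> D \<and> (\<forall>x\<in>D. \<forall>y\<in>D. x + y \<in> D) \<and> (\<forall>c. \<forall>x\<in>D. c *\<^sub>C x \<in> D)"

definition bounded_clinear :: "('a::complex_inner \<Rightarrow> 'a) \<Rightarrow> bool" where
  "bounded_clinear S \<longleftrightarrow> bounded_linear S \<and> (\<forall>c x. S (c *\<^sub>C x) = c *\<^sub>C S x)"

section \<open>Semigroups of m-isometries and their generators\<close>

definition m_isometric :: "nat \<Rightarrow> ('a::complex_inner \<Rightarrow> 'a) \<Rightarrow> bool" where
  "m_isometric m S \<longleftrightarrow> bounded_clinear S \<and>
     (\<forall>x. (\<Sum>k=0..m. (- 1) ^ (m - k) * real (m choose k) * (norm ((S ^^ k) x))\<^sup>2) = 0)"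

text \<open>Semigroups are indexed by \<^typ>\<open>real\<close>; their values at negative times are irrelevant.\<close>

definition C0_semigroup :: "(real \<Rightarrow> 'a::complex_inner \<Rightarrow> 'a) \<Rightarrow> bool" where
  "C0_semigroup T \<longleftrightarrow>
     (\<forall>t\<ge>0. bounded_clinear (T t)) \<and>
     (\<forall>x. T 0 x = x) \<and>
     (\<forall>s\<ge>0. \<forall>t\<ge>0. \<forall>x. T (s + t) x = T s (T t x)) \<and>
     (\<forall>x. ((\<lambda>t. T t x) \<longlongrightarrow> x) (at_right 0))"

definition m_isometric_semigroup :: "nat \<Rightarrow> (real \<Rightarrow> 'a::complex_inner \<Rightarrow> 'a) \<Rightarrow> bool" where
  "m_isometric_semigroup m T \<longleftrightarrow> C0_semigroup T \<and> (\<forall>t\<ge>0. m_isometric m (T t))"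

definition generator_domain :: "(real \<Rightarrow> 'a::complex_inner \<Rightarrow> 'a) \<Rightarrow> 'a set" where
  "generator_domain T = {x. \<exists>y. ((\<lambda>t. (T t x - x) /\<^sub>R t) \<longlongrightarrow> y) (at_right 0)}"

text \<open>Meaningful only on \<open>generator_domain T\<close>.\<close>

definition generator :: "(real \<Rightarrow> 'a::complex_inner \<Rightarrow> 'a) \<Rightarrow> 'a \<Rightarrow> 'a" where
  "generator T x = Lim (at_right 0) (\<lambda>t. (T t x - x) /\<^sub>R t)"

text \<open>
  \<open>domain_power D A j\<close> is the domain of the \<open>j\<close>-th power of the
  unbounded operator \<open>A\<close> with domain \<open>D\<close>. On it, the total function \<open>A ^^ i\<close>
  agrees with the \<open>i\<close>-th power of that operator for every \<open>i \<le> j\<close>.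
\<close>

primrec domain_power :: "'a set \<Rightarrow> ('a \<Rightarrow> 'a) \<Rightarrow> nat \<Rightarrow> 'a set" where
  "domain_power D A 0 = UNIV"
| "domain_power D A (Suc j) = {y \<in> D. A y \<in> domain_power D A j}"

section \<open>Quadratic forms\<close>

definition sesquilinear_on ::
    "'a::complex_inner set \<Rightarrow> ('a \<Rightarrow> 'a \<Rightarrow> complex) \<Rightarrow> bool" where
  "sesquilinear_on D b \<longleftrightarrow>
     (\<forall>x\<in>D. \<forall>y\<in>D. \<forall>z\<in>D. b (x + y) z = b x z + b y z \<and> b z (x + y) = b z x + b z y) \<and>
     (\<forall>c. \<forall>x\<in>D. \<forall>z\<in>D. b (c *\<^sub>C x) z = c * b x z \<and> b z (c *\<^sub>C x) = cnj c * b z x)"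

definition quadratic_form_on :: "'a::complex_inner set \<Rightarrow> ('a \<Rightarrow> complex) \<Rightarrow> bool" where
  "quadratic_form_on D q \<longleftrightarrow>
     csubspace D \<and> (\<exists>b. sesquilinear_on D b \<and> (\<forall>y\<in>D. q y = b y y))"

definition bounded_form_on :: "'a::complex_inner set \<Rightarrow> ('a \<Rightarrow> complex) \<Rightarrow> bool" where
  "bounded_form_on D q \<longleftrightarrow>
     quadratic_form_on D q \<and> (\<exists>C. \<forall>y\<in>D. cmod (q y) \<le> C * (norm y)\<^sup>2)"

text \<open>
  Bounded forms on the whole space are continuous (polarization), so for a dense
  subspace \<open>D\<close> and a bounded form \<open>q\<close> on it the description below determines a
  unique function, the extension of \<open>q\<close> by continuity.
\<close>

definition bounded_extension ::
    "'a::complex_inner set \<Rightarrow> ('a \<Rightarrow> complex) \<Rightarrow> 'a \<Rightarrow> complex" where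
  "bounded_extension D q =
     (THE Q. bounded_form_on UNIV Q \<and> continuous_on UNIV Q \<and> (\<forall>y\<in>D. Q y = q y))"

definition alpha :: "('a::complex_inner \<Rightarrow> 'a) \<Rightarrow> nat \<Rightarrow> 'a \<Rightarrow> complex" where
  "alpha A j y = (\<Sum>i=0..j. of_nat (j choose i) * cinner ((A ^^ i) y) ((A ^^ (j - i)) y))"

end

theory Submission
  imports Defs "HOL-Computational_Algebra.Polynomial"
begin

text \<open>
  For fixed \<open>x\<close> the function \<open>f t = (norm (T t x))\<^sup>2\<close> is right continuous, and m-isometry of \<open>T h\<close>,
  applied to \<open>T s x\<close>, says that the \<open>m\<close>-th forward differences of \<open>f\<close> with step \<open>h\<close> vanish. Hence
  \<open>f\<close> agrees on every rational grid, and then everywhere, with the polynomial of degree below \<open>m\<close>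
  interpolating it at \<open>0, \<dots>, m - 1\<close>. Its coefficients are fixed linear combinations of the
  \<open>(norm (T k x))\<^sup>2\<close> with \<open>k < m\<close>, so they are bounded continuous quadratic forms in \<open>x\<close>. If \<open>x\<close>
  lies in the domain of the \<open>j\<close>-th power of the generator, the \<open>j\<close>-th right derivative of \<open>f\<close> at
  \<open>0\<close> is given by the Leibniz rule and equals \<open>alpha A j x\<close>. The domains are dense because
  \<open>integral {0..r} (\<lambda>s. T s x) /\<^sub>R r\<close> tends to \<open>x\<close> and lies in the domain of the next power;
  the strong continuity this needs follows from the polynomial bound on \<open>f\<close>.
\<close>

section \<open>Forward differences and interpolation\<close>

text \<open>Pascal's rule summed over \<open>k\<close>. It is stated over a semiring because it
  serves real forward differences as well as the complex Leibniz rule.\<close>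

lemma sum_choose_Suc:
  fixes F :: "nat \<Rightarrow> 'a::comm_semiring_1"
  shows "(\<Sum>k=0..Suc m. of_nat (Suc m choose k) * F k)
    = (\<Sum>k=0..m. of_nat (m choose k) * (F k + F (Suc k)))"
proof -
  have "(\<Sum>k=0..m. of_nat (m choose k) * F k) = (\<Sum>k=0..Suc m. of_nat (m choose k) * F k)"
    by (simp add: binomial_eq_0)
  also have "\<dots> = F 0 + (\<Sum>k=0..m. of_nat (m choose Suc k) * F (Suc k))"
    by (subst sum.atLeast0_atMost_Suc_shift) simp
  finally show ?thesis
    by (subst sum.atLeast0_atMost_Suc_shift)
      (simp add: sum.distrib distrib_left distrib_right add_ac)
qed

definition fdiff :: "(nat \<Rightarrow> real) \<Rightarrow> nat \<Rightarrow> real" where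
  "fdiff a n = a (Suc n) - a n"

lemma funpow_fdiff:
  "(fdiff ^^ m) a n = (\<Sum>k=0..m. (- 1) ^ (m - k) * real (m choose k) * a (n + k))"
proof (induction m arbitrary: n)
  case (Suc m)
  \<comment> \<open>The sign goes into \<open>F\<close>: for \<open>k <= m\<close>,
    \<open>F k\<close> carries the opposite of the sign \<open>(- 1) ^ (m - k)\<close> and
    \<open>F (Suc k)\<close> exactly that sign, so the difference becomes the sum in
    \<open>sum_choose_Suc\<close>.\<close>
  define F where "F k = (- 1) ^ (Suc m - k) * a (n + k)" for k
  have "(fdiff ^^ Suc m) a n =
      (\<Sum>k=0..m. (- 1) ^ (m - k) * real (m choose k) * (a (n + Suc k) - a (n + k)))"
    by (simp add: fdiff_def Suc sum_subtractf right_diff_distrib)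
  also have "\<dots> = (\<Sum>k=0..m. of_nat (m choose k) * (F k + F (Suc k)))"
    by (intro sum.cong) (auto simp: F_def Suc_diff_le algebra_simps)
  also have "\<dots> = (\<Sum>k=0..Suc m. of_nat (Suc m choose k) * F k)"
    by (rule sum_choose_Suc [symmetric])
  finally show ?case
    by (simp add: F_def mult_ac)
qed simp

text \<open>The induction hypothesis expands both \<open>a\<close> and \<open>fdiff a\<close>, which
  is why \<open>a\<close> is generalised; Pascal's rule merges the two expansions.\<close>

lemma newton_forward_difference:
  "a n = (\<Sum>i=0..n. real (n choose i) * (fdiff ^^ i) a 0)"
proof (induction n arbitrary: a)
  case (Suc n)
  have "a (Suc n) = a n + fdiff a n"
    by (simp add: fdiff_def)
  also have "\<dots> = (\<Sum>i=0..n. real (n choose i) * ((fdiff ^^ i) a 0 + (fdiff ^^ Suc i) a 0))"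
    unfolding Suc.IH [of a] Suc.IH [of "fdiff a"]
    by (simp add: sum.distrib distrib_left funpow_swap1)
  finally show ?case
    by (simp only: sum_choose_Suc)
qed simp

section \<open>Binomial polynomials and interpolation at 0, ..., m - 1\<close>

definition binomial_poly :: "nat \<Rightarrow> real poly" where
  "binomial_poly i = smult (1 / fact i) (\<Prod>k=0..<i. [:- real k, 1:])"

lemma poly_binomial_poly: "poly (binomial_poly i) (real n) = real (n choose i)"
  by (simp add: binomial_poly_def poly_prod binomial_gbinomial gbinomial_prod_rev)

lemma degree_binomial_poly: "degree (binomial_poly i) \<le> i"
proof -
  have "degree (\<Prod>k=0..<i. [:- real k, 1:]) \<le> (\<Sum>k=0..<i. 1)"
    by (rule order.trans [OF degree_prod_sum_le]) simp_all
  then show ?thesis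
    by (simp add: binomial_poly_def)
qed

text \<open>For \<open>k < m\<close> this is the Lagrange basis polynomial of the node
  \<open>k\<close>, written as what Newton's series contributes to the value \<open>a k\<close>. It
  does not depend on the data, so the coefficients of the interpolant are linear in the
  values.\<close>

definition interpolation_basis :: "nat \<Rightarrow> nat \<Rightarrow> real poly" where
  "interpolation_basis m k =
     (\<Sum>i<m. smult ((- 1) ^ (i - k) * real (i choose k)) (binomial_poly i))"

definition interpolation_poly :: "nat \<Rightarrow> (nat \<Rightarrow> real) \<Rightarrow> real poly" where
  "interpolation_poly m a = (\<Sum>k<m. smult (a k) (interpolation_basis m k))"

lemma coeff_interpolation_poly_eq_0:
  assumes "m \<le> j"
  shows "coeff (interpolation_poly m a) j = 0"
proof -
  have "coeff (binomial_poly i) j = 0" if "i < m" for i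
    using degree_binomial_poly [of i] that assms by (intro coeff_eq_0) linarith
  then show ?thesis
    by (simp add: interpolation_poly_def interpolation_basis_def coeff_sum)
qed

text \<open>Vanishing \<open>m\<close>-th differences annihilate all higher ones, so Newton's series
  stops below \<open>m\<close> and the interpolant is exact at every natural number, not only at its
  nodes.\<close>

lemma poly_interpolation_poly:
  assumes "\<And>n. (fdiff ^^ m) a n = 0"
  shows "poly (interpolation_poly m a) (real n) = a n"
proof -
  have zero: "(fdiff ^^ i) a 0 = 0" if "m \<le> i" for i
  proof -
    have "(fdiff ^^ (j + m)) a = (\<lambda>n. 0)" for j
    proof (induction j)
      case 0
      show ?case by (simp add: fun_eq_iff assms)
    next
      case (Suc j)
      then show ?case by (simp add: fun_eq_iff) (simp add: fdiff_def)
    qed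
    from this [of "i - m"] show ?thesis
      using that by simp
  qed
  have diff: "(\<Sum>k<m. a k * ((- 1) ^ (i - k) * real (i choose k))) = (fdiff ^^ i) a 0"
    if "i < m" for i
  proof -
    have "(\<Sum>k<m. a k * ((- 1) ^ (i - k) * real (i choose k)))
        = (\<Sum>k=0..i. a k * ((- 1) ^ (i - k) * real (i choose k)))"
      using that by (intro sum.mono_neutral_right) auto
    then show ?thesis
      by (simp add: funpow_fdiff mult_ac)
  qed
  have "poly (interpolation_poly m a) (real n)
      = (\<Sum>k<m. \<Sum>i<m. real (n choose i) * (a k * ((- 1) ^ (i - k) * real (i choose k))))"
    by (simp add: interpolation_poly_def interpolation_basis_def poly_sum poly_binomial_poly
        sum_distrib_left mult_ac)
  also have "\<dots> = (\<Sum>i<m. real (n choose i) *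
      (\<Sum>k<m. a k * ((- 1) ^ (i - k) * real (i choose k))))"
    by (subst sum.swap) (simp add: sum_distrib_left)
  also have "\<dots> = (\<Sum>i<m. real (n choose i) * (fdiff ^^ i) a 0)"
    by (intro sum.cong) (simp_all add: diff)
  \<comment> \<open>Pass through a common range: the differences vanish from \<open>m\<close> on,
    the binomial coefficients beyond \<open>n\<close>.\<close>
  also have "\<dots> = (\<Sum>i<max m (Suc n). real (n choose i) * (fdiff ^^ i) a 0)"
    by (intro sum.mono_neutral_left) (auto simp: zero)
  also have "\<dots> = (\<Sum>i=0..n. real (n choose i) * (fdiff ^^ i) a 0)"
    by (intro sum.mono_neutral_right) auto
  finally show ?thesis
    using newton_forward_difference [of a n] by simp
qed

lemma poly_eqI_real_of_nat:
  fixes p q :: "real poly"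
  assumes "\<And>n. poly p (real n) = poly q (real n)"
  shows "p = q"
proof (rule ccontr)
  assume "p \<noteq> q"
  then have "finite {x. poly (p - q) x = 0}"
    by (intro poly_roots_finite) simp
  moreover have "range real \<subseteq> {x. poly (p - q) x = 0}"
    using assms by auto
  ultimately have "finite (range real)"
    by (rule rev_finite_subset)
  then show False
    using finite_imageD [of real UNIV] by (simp add: inj_on_def)
qed

text \<open>Each grid of step \<open>1 / b\<close> carries an interpolating polynomial. All of them
  agree at the integers after rescaling, hence are one polynomial, and right continuity passes from
  nonnegative rationals to reals.\<close>

lemma frechet_equation_right_continuous:
  fixes f :: "real \<Rightarrow> real"
  assumes diff: "\<And>s h. 0 \<le> s \<Longrightarrow> 0 \<le> h \<Longrightarrow>
      (\<Sum>k=0..m. (- 1) ^ (m - k) * real (m choose k) * f (s + real k * h)) = 0"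
    and cont: "\<And>t. 0 \<le> t \<Longrightarrow> (f \<longlongrightarrow> f t) (at_right t)"
    and "0 \<le> t"
  shows "f t = poly (interpolation_poly m (\<lambda>k. f (real k))) t"
proof -
  define p where "p = interpolation_poly m (\<lambda>k. f (real k))"
  have grid: "poly (interpolation_poly m (\<lambda>k. f (real k * h))) (real n) = f (real n * h)"
    if "0 \<le> h" for n h
    using diff [of "real n * h" h for n] that
    by (subst poly_interpolation_poly) (auto simp: funpow_fdiff algebra_simps)
  have rat: "poly p (real n / real b) = f (real n / real b)" if "b > 0" for n b
  proof -
    define q where "q = interpolation_poly m (\<lambda>k. f (real k * (1 / real b)))"
    have q: "poly q (real n) = f (real n / real b)" for n
      using grid [of "1 / real b" n] by (simp add: q_def)
    \<comment> \<open>\<open>q\<close> measures time in units of \<open>1 / b\<close>. Substituting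
      \<open>b * x\<close> undoes this, and both sides take the value of \<open>f\<close> at every
      natural number.\<close>
    have "p = pcompose q [:0, real b:]"
      using q [of "n * b" for n] grid [of 1] that
      by (intro poly_eqI_real_of_nat) (simp add: p_def poly_pcompose mult.commute)
    then show ?thesis
      using q [of n] that by (simp add: poly_pcompose)
  qed
  have "((\<lambda>s. f s - poly p s) \<longlongrightarrow> f t - poly p t) (at_right t)"
    by (intro tendsto_intros cont \<open>0 \<le> t\<close>)
  then have ev: "\<forall>\<^sub>F s in at_right t. dist (f s - poly p s) (f t - poly p t) < e" if "e > 0" for e
    using that by (rule tendstoD)
  have "f t - poly p t = 0"
  proof (rule ccontr)
    assume "f t - poly p t \<noteq> 0"
    then have "\<forall>\<^sub>F s in at_right t. f s - poly p s \<noteq> 0"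
      using ev [of "\<bar>f t - poly p t\<bar>"] by (auto elim!: eventually_mono simp: dist_real_def)
    then obtain u where u: "t < u" "\<And>s. t < s \<Longrightarrow> s < u \<Longrightarrow> f s - poly p s \<noteq> 0"
      by (auto simp: eventually_at_right_field)
    \<comment> \<open>A rational to the right of \<open>t\<close> is nonnegative, so it is a grid
      point, where \<open>f\<close> and \<open>p\<close> agree.\<close>
    obtain r where r: "r \<in> \<rat>" "t < r" "r < u"
      using Rats_dense_in_real [OF u(1)] by blast
    obtain n b where "b \<noteq> 0" "\<bar>r\<bar> = real n / real b"
      using Rats_abs_nat_div_natE [OF r(1)] by blast
    then show False
      using u(2) [OF r(2,3)] rat [of b n] r(2) \<open>0 \<le> t\<close> by simp
  qed
  then show ?thesis
    by (simp add: p_def)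
qed

section \<open>Complex inner products\<close>

text \<open>Completeness is what allows continuous orbits to be integrated below.\<close>

instance complex_hilbert \<subseteq> banach ..

lemma bounded_clinear_imp_linear: "bounded_clinear S \<Longrightarrow> bounded_linear S"
  and bounded_clinear_scaleC: "bounded_clinear S \<Longrightarrow> S (c *\<^sub>C x) = c *\<^sub>C S x"
  by (simp_all add: bounded_clinear_def)

lemma cinner_add_right: "cinner x (y + z) = cinner x y + cinner x z"
  by (metis cinner_add_left cinner_commute complex_cnj_add)

lemma cinner_scaleC_right: "cinner x (c *\<^sub>C y) = cnj c * cinner x y"
  by (metis cinner_scaleC_left cinner_commute complex_cnj_mult)

lemma cinner_self: "cinner x x = complex_of_real ((norm x)\<^sup>2)"
proof -
  have "Im (cinner x x) = 0"
    using arg_cong [OF cinner_commute [of x x], of Im] by simp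
  then show ?thesis
    by (simp add: complex_eq_iff Re_cinner dot_square_norm)
qed

lemma norm_scaleC:
  fixes x :: "'a::complex_inner"
  shows "norm (c *\<^sub>C x) = cmod c * norm x"
proof -
  have "cinner (c *\<^sub>C x) (c *\<^sub>C x) = (c * cnj c) * cinner x x"
    by (simp add: cinner_scaleC_left cinner_scaleC_right)
  then have "complex_of_real ((norm (c *\<^sub>C x))\<^sup>2) = complex_of_real ((cmod c * norm x)\<^sup>2)"
    by (simp add: cinner_self complex_norm_square [symmetric] power_mult_distrib del: of_real_power)
  then show ?thesis
    by (simp only: of_real_eq_iff) (simp add: power2_eq_iff_nonneg)
qed

lemma bounded_linear_scaleC: "bounded_linear ((*\<^sub>C) c :: 'a::complex_inner \<Rightarrow> 'a)"
proof (rule bounded_linear_intro [where K = "cmod c"])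
  show "c *\<^sub>C r *\<^sub>R x = r *\<^sub>R c *\<^sub>C x" for r and x :: 'a
    unfolding scaleC_of_real [symmetric] scaleC_scaleC by (simp add: mult.commute)
qed (simp_all add: scaleC_add_right norm_scaleC mult.commute)

text \<open>Real Cauchy-Schwarz bounds the real and imaginary parts separately, whence the factor 2;
  any constant suffices for \<open>bounded_bilinear_cinner\<close>.\<close>

lemma norm_cinner_le: "cmod (cinner x y) \<le> 2 * norm x * norm y"
proof -
  have "\<bar>Im (cinner x y)\<bar> = \<bar>inner ((- \<i>) *\<^sub>C x) y\<bar>"
    by (simp add: Re_cinner [symmetric] cinner_scaleC_left)
  also have "\<dots> \<le> norm x * norm y"
    using Cauchy_Schwarz_ineq2 [of "(- \<i>) *\<^sub>C x" y] by (simp add: norm_scaleC)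
  finally have "\<bar>Im (cinner x y)\<bar> \<le> norm x * norm y" .
  moreover have "\<bar>Re (cinner x y)\<bar> \<le> norm x * norm y"
    by (simp add: Re_cinner Cauchy_Schwarz_ineq2)
  ultimately show ?thesis
    using cmod_le [of "cinner x y"] by linarith
qed

text \<open>Over the reals the sesquilinear product is bilinear, which gives the product rule for
  derivatives of \<open>cinner\<close>.\<close>

lemma bounded_bilinear_cinner: "bounded_bilinear cinner"
proof
  show "cinner (r *\<^sub>R x) y = r *\<^sub>R cinner x y" for r and x y :: 'a
    unfolding scaleC_of_real [of r x, symmetric] cinner_scaleC_left by (simp add: scaleR_conv_of_real)
  show "cinner x (r *\<^sub>R y) = r *\<^sub>R cinner x y" for r and x y :: 'a
    unfolding scaleC_of_real [of r y, symmetric] cinner_scaleC_right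
    by (simp add: scaleR_conv_of_real)
  show "\<exists>K. \<forall>x y :: 'a. cmod (cinner x y) \<le> norm x * norm y * K"
    using norm_cinner_le [where 'a = 'a] by (intro exI [of _ 2]) (simp add: mult_ac)
qed (simp_all add: cinner_add_left cinner_add_right)

section \<open>Semigroups and generators\<close>

lemma at_within_atLeast: "at t within {t..} = at_right (t::real)"
proof -
  have "{t..} - {t} = {t<..} - {t}"
    by auto
  then show ?thesis
    by (simp add: at_within_def)
qed

text \<open>Connects the difference quotients that define the generator with the general calculus of
  derivatives.\<close>

lemma has_vector_derivative_right_iff:
  fixes f :: "real \<Rightarrow> 'b::real_normed_vector"
  shows "(f has_vector_derivative D) (at t within {t..}) \<longleftrightarrow>
    ((\<lambda>h. (f (t + h) - f t) /\<^sub>R h) \<longlongrightarrow> D) (at_right 0)"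
proof -
  have "(f has_vector_derivative D) (at t within {t..}) \<longleftrightarrow>
      ((\<lambda>h. (f (t + h) - f t - h *\<^sub>R D) /\<^sub>R norm h) \<longlongrightarrow> 0) (at_right 0)"
    by (simp add: has_vector_derivative_def has_derivative_at_within bounded_linear_scaleR_left
        at_within_atLeast filterlim_at_right_to_0 [of _ _ t] add.commute)
  also have "\<dots> \<longleftrightarrow> ((\<lambda>h. (f (t + h) - f t) /\<^sub>R h - D) \<longlongrightarrow> 0) (at_right 0)"
    by (intro tendsto_cong eventually_at_rightI [of 0 1]) (simp_all add: scaleR_diff_right)
  finally show ?thesis
    by (simp add: LIM_zero_iff)
qed

context
  fixes T :: "real \<Rightarrow> 'a::complex_inner \<Rightarrow> 'a"
  assumes C0: "C0_semigroup T"
begin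

lemma C0_bounded_clinear: "0 \<le> t \<Longrightarrow> bounded_clinear (T t)"
  and C0_zero: "T 0 x = x"
  and C0_add: "0 \<le> s \<Longrightarrow> 0 \<le> t \<Longrightarrow> T (s + t) x = T s (T t x)"
  and C0_tendsto: "((\<lambda>t. T t x) \<longlongrightarrow> x) (at_right 0)"
  using C0 by (auto simp: C0_semigroup_def)

lemma C0_bounded_linear: "0 \<le> t \<Longrightarrow> bounded_linear (T t)"
  by (intro bounded_clinear_imp_linear C0_bounded_clinear)

lemma C0_commute: "0 \<le> s \<Longrightarrow> 0 \<le> t \<Longrightarrow> T s (T t x) = T t (T s x)"
  by (metis C0_add add.commute)

lemma C0_funpow: "0 \<le> t \<Longrightarrow> (T t ^^ k) x = T (real k * t) x"
  by (induction k) (simp_all add: C0_zero C0_add [symmetric] algebra_simps)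

text \<open>By the semigroup law this is continuity at 0 of the orbit of
  \<open>T t x\<close>.\<close>

lemma C0_right_continuous:
  assumes "0 \<le> t"
  shows "((\<lambda>s. T s x) \<longlongrightarrow> T t x) (at_right t)"
proof -
  have "((\<lambda>s. T (s + t) x) \<longlongrightarrow> T t x) (at_right 0)"
    using C0_tendsto [of "T t x"]
    by (rule Lim_transform_eventually)
      (use assms in \<open>auto intro!: eventually_at_rightI [of 0 1] simp: C0_add\<close>)
  then show ?thesis
    by (simp add: filterlim_at_right_to_0 [of _ _ t])
qed

section \<open>The generator and the domains of its powers\<close>

lemma generator_tendsto:
  assumes "x \<in> generator_domain T"
  shows "((\<lambda>h. (T h x - x) /\<^sub>R h) \<longlongrightarrow> generator T x) (at_right 0)"
proof -
  from assms obtain y where "((\<lambda>h. (T h x - x) /\<^sub>R h) \<longlongrightarrow> y) (at_right 0)"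
    by (auto simp: generator_domain_def)
  moreover from this have "generator T x = y"
    unfolding generator_def by (intro tendsto_Lim) simp_all
  ultimately show ?thesis
    by simp
qed

lemma generatorI:
  assumes "((\<lambda>h. (T h x - x) /\<^sub>R h) \<longlongrightarrow> y) (at_right 0)"
  shows "x \<in> generator_domain T" "generator T x = y"
  using assms tendsto_Lim [OF _ assms] by (auto simp: generator_domain_def generator_def)

lemma generator_add:
  assumes "x \<in> generator_domain T" "y \<in> generator_domain T"
  shows "x + y \<in> generator_domain T" "generator T (x + y) = generator T x + generator T y"
proof -
  have "((\<lambda>h. (T h x - x) /\<^sub>R h + (T h y - y) /\<^sub>R h) \<longlongrightarrow> generator T x + generator T y) (at_right 0)"
    by (intro tendsto_add generator_tendsto assms)
  then have "((\<lambda>h. (T h (x + y) - (x + y)) /\<^sub>R h) \<longlongrightarrow> generator T x + generator T y) (at_right 0)"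
    by (rule Lim_transform_eventually)
      (auto intro!: eventually_at_rightI [of 0 1]
        simp: linear_add [OF bounded_linear.linear [OF C0_bounded_linear]] algebra_simps)
  then show "x + y \<in> generator_domain T" "generator T (x + y) = generator T x + generator T y"
    by (rule generatorI)+
qed

text \<open>A bounded operator commuting with the semigroup can be pulled through the difference
  quotients. Used both for complex scalars and for \<open>S = T t\<close>.\<close>

lemma generator_image:
  assumes "x \<in> generator_domain T" and "bounded_linear S"
    and comm: "\<And>h. 0 < h \<Longrightarrow> T h (S x) = S (T h x)"
  shows "S x \<in> generator_domain T" "generator T (S x) = S (generator T x)"
proof -
  interpret S: bounded_linear S by fact
  have "((\<lambda>h. S ((T h x - x) /\<^sub>R h)) \<longlongrightarrow> S (generator T x)) (at_right 0)"
    by (intro S.tendsto generator_tendsto assms)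
  then have "((\<lambda>h. (T h (S x) - S x) /\<^sub>R h) \<longlongrightarrow> S (generator T x)) (at_right 0)"
    by (rule Lim_transform_eventually)
      (auto intro!: eventually_at_rightI [of 0 1] simp: S.scaleR S.diff comm)
  then show "S x \<in> generator_domain T" "generator T (S x) = S (generator T x)"
    by (rule generatorI)+
qed

lemmas generator_scaleC = generator_image [OF _ bounded_linear_scaleC]

lemma generator_zero: "0 \<in> generator_domain T" "generator T 0 = 0"
  by (rule generatorI; rule Lim_transform_eventually [OF tendsto_const];
      auto intro!: eventually_at_rightI [of 0 1]
        simp: linear_0 [OF bounded_linear.linear [OF C0_bounded_linear]])+

lemma generator_semigroup:
  assumes "x \<in> generator_domain T" "0 \<le> t"
  shows "T t x \<in> generator_domain T" "generator T (T t x) = T t (generator T x)"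
  using assms by (auto intro!: generator_image [OF _ C0_bounded_linear] C0_commute)

lemma semigroup_right_derivative:
  assumes "x \<in> generator_domain T" "0 \<le> t"
  shows "((\<lambda>s. T s x) has_vector_derivative T t (generator T x)) (at t within {t..})"
  unfolding has_vector_derivative_right_iff
  using generator_tendsto [OF generator_semigroup(1) [OF assms]]
  unfolding generator_semigroup(2) [OF assms]
  by (rule Lim_transform_eventually)
    (use assms(2) in \<open>auto intro!: eventually_at_rightI [of 0 1] simp: C0_add C0_commute\<close>)

lemma csubspace_domain_power: "csubspace (domain_power (generator_domain T) (generator T) n)"
proof -
  let ?D = "domain_power (generator_domain T) (generator T)"
  have "0 \<in> ?D n \<and> (\<forall>x\<in>?D n. \<forall>y\<in>?D n. x + y \<in> ?D n) \<and> (\<forall>c. \<forall>x\<in>?D n. c *\<^sub>C x \<in> ?D n)"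
  proof (induction n)
    case (Suc n)
    then show ?case
      by (simp add: generator_zero generator_add generator_scaleC
          bounded_clinear_scaleC C0_bounded_clinear)
  qed simp
  then show ?thesis
    by (simp add: csubspace_def)
qed

lemma domain_power_semigroup:
  assumes "0 \<le> t" "x \<in> domain_power (generator_domain T) (generator T) n"
  shows "T t x \<in> domain_power (generator_domain T) (generator T) n"
  using assms(2)
  by (induction n arbitrary: x) (simp_all add: generator_semigroup assms(1))

end

lemma funpow_in_domain:
  assumes "x \<in> domain_power D A n" "i < n"
  shows "(A ^^ i) x \<in> D"
  using assms
proof (induction n arbitrary: x i)
  case (Suc n)
  then show ?case
    by (cases i) (auto simp: funpow_swap1)
qed simp

lemma domain_power_mono:
  assumes "x \<in> domain_power D A (Suc n)"
  shows "x \<in> domain_power D A n"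
  using assms by (induction n arbitrary: x) auto

section \<open>Growth of m-isometric semigroups and density of the domains\<close>

lemma semigroup_norm_poly:
  assumes "m_isometric_semigroup m T" "0 \<le> t"
  shows "(norm (T t x))\<^sup>2 = poly (interpolation_poly m (\<lambda>k. (norm (T (real k) x))\<^sup>2)) t"
proof (rule frechet_equation_right_continuous [OF _ _ assms(2)])
  have C0: "C0_semigroup T"
    using assms(1) by (simp add: m_isometric_semigroup_def)
  fix s h :: real
  assume "0 \<le> s" "0 \<le> h"
  have "(T h ^^ k) (T s x) = T (s + real k * h) x" for k
    using \<open>0 \<le> s\<close> \<open>0 \<le> h\<close>
    by (simp add: C0_funpow [OF C0] C0_add [OF C0, symmetric] add.commute)
  moreover have "(\<Sum>k=0..m. (- 1) ^ (m - k) * real (m choose k) * (norm ((T h ^^ k) (T s x)))\<^sup>2) = 0"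
    using assms(1) \<open>0 \<le> h\<close> by (simp add: m_isometric_semigroup_def m_isometric_def)
  ultimately show "(\<Sum>k=0..m. (- 1) ^ (m - k) * real (m choose k) * (norm (T (s + real k * h) x))\<^sup>2) = 0"
    by simp
next
  fix t :: real
  assume "0 \<le> t"
  then show "((\<lambda>s. (norm (T s x))\<^sup>2) \<longlongrightarrow> (norm (T t x))\<^sup>2) (at_right t)"
    using assms(1) by (intro tendsto_intros C0_right_continuous) (auto simp: m_isometric_semigroup_def)
qed

text \<open>The polynomial formula bounds \<open>norm (T t x)\<close> by the finitely many operators
  \<open>T k\<close> with \<open>k < m\<close>, with weights that are bounded on the compact
  interval.\<close>

lemma semigroup_locally_bounded:
  assumes "m_isometric_semigroup m T"
  obtains M where "0 < M" "\<And>t x. 0 \<le> t \<Longrightarrow> t \<le> b \<Longrightarrow> norm (T t x) \<le> M * norm x"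
proof -
  have C0: "C0_semigroup T"
    using assms by (simp add: m_isometric_semigroup_def)
  have "\<exists>B. \<forall>t\<in>{0..b}. \<bar>poly (interpolation_basis m k) t\<bar> \<le> B" for k
  proof -
    have "compact (poly (interpolation_basis m k) ` {0..b})"
      by (intro compact_continuous_image continuous_on_poly continuous_on_id compact_Icc)
    then show ?thesis
      by (auto simp: bounded_iff dest: compact_imp_bounded)
  qed
  then obtain B where B: "\<And>k t. t \<in> {0..b} \<Longrightarrow> \<bar>poly (interpolation_basis m k) t\<bar> \<le> B k"
    by metis
  \<comment> \<open>The absolute value keeps \<open>C\<close> nonnegative even for
    \<open>b < 0\<close>, where \<open>B k\<close> is arbitrary.\<close>
  define C where "C = (\<Sum>k<m. (onorm (T (real k)))\<^sup>2 * \<bar>B k\<bar>)"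
  \<comment> \<open>Adding 1 makes the bound strictly positive, so that it can be divided by
    later.\<close>
  have bound: "norm (T t x) \<le> (sqrt C + 1) * norm x" if "0 \<le> t" "t \<le> b" for t x
  proof -
    have "(norm (T t x))\<^sup>2 = (\<Sum>k<m. (norm (T (real k) x))\<^sup>2 * poly (interpolation_basis m k) t)"
      unfolding semigroup_norm_poly [OF assms \<open>0 \<le> t\<close>]
      by (simp add: interpolation_poly_def poly_sum)
    also have "\<dots> \<le> (\<Sum>k<m. (onorm (T (real k)) * norm x)\<^sup>2 * \<bar>B k\<bar>)"
    proof (rule sum_mono)
      fix k
      have "norm (T (real k) x) \<le> onorm (T (real k)) * norm x"
        by (intro onorm C0_bounded_linear [OF C0]) simp
      moreover have "poly (interpolation_basis m k) t \<le> \<bar>B k\<bar>"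
        using B [where t = t and k = k] that by simp
      ultimately show "(norm (T (real k) x))\<^sup>2 * poly (interpolation_basis m k) t
          \<le> (onorm (T (real k)) * norm x)\<^sup>2 * \<bar>B k\<bar>"
        by (meson abs_ge_zero mult_left_mono mult_right_mono norm_ge_zero order_trans power_mono
            zero_le_power2)
    qed
    also have "\<dots> = C * (norm x)\<^sup>2"
      by (simp add: C_def sum_distrib_left sum_distrib_right power_mult_distrib mult_ac)
    finally have "norm (T t x) \<le> sqrt (C * (norm x)\<^sup>2)"
      by (rule real_le_rsqrt)
    then show ?thesis
      by (simp add: real_sqrt_mult distrib_right add_increasing2)
  qed
  have "0 \<le> C"
    by (simp add: C_def sum_nonneg)
  then show ?thesis
    using bound by (intro that [of "sqrt C + 1"]) (simp_all add: add_nonneg_pos)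
qed

lemma semigroup_continuous_on:
  assumes "m_isometric_semigroup m T"
  shows "continuous_on {0..b} (\<lambda>t. T t x)"
  unfolding continuous_on_iff
proof (intro ballI allI impI)
  have C0: "C0_semigroup T"
    using assms by (simp add: m_isometric_semigroup_def)
  obtain M where M: "0 < M" "\<And>t x. 0 \<le> t \<Longrightarrow> t \<le> b \<Longrightarrow> norm (T t x) \<le> M * norm x"
    using semigroup_locally_bounded [OF assms] by metis
  fix t and e :: real
  assume t: "t \<in> {0..b}" and "0 < e"
  have "\<forall>\<^sub>F h in at_right 0. dist (T h x) x < e / M"
    using C0_tendsto [OF C0] \<open>0 < e\<close> M(1) by (intro tendstoD) simp_all
  then obtain d where d: "0 < d" "\<And>h. 0 < h \<Longrightarrow> h < d \<Longrightarrow> dist (T h x) x < e / M"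
    by (auto simp: eventually_at_right_field)
  \<comment> \<open>Factoring out the earlier time \<open>v\<close> leaves
    \<open>T (u - v) x - x\<close>, so one estimate gives continuity from both sides.\<close>
  have ord: "dist (T u x) (T v x) < e" if "0 \<le> v" "v < u" "v \<le> b" "u - v < d" for u v
  proof -
    interpret S: bounded_linear "T v"
      using C0_bounded_linear [OF C0] that by simp
    have "dist (T u x) (T v x) = norm (T v (T (u - v) x - x))"
      using C0_add [OF C0, of v "u - v" x] that by (simp add: dist_norm S.diff)
    also have "\<dots> \<le> M * dist (T (u - v) x) x"
      using M(2) [of v] that by (simp add: dist_norm)
    also have "\<dots> < M * (e / M)"
      using d(2) [of "u - v"] that M(1) by (intro mult_strict_left_mono) simp_all
    finally show ?thesis
      using M(1) by simp
  qed
  have "dist (T s x) (T t x) < e" if "s \<in> {0..b}" "dist s t < d" for s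
    using ord [of t s] ord [of s t] that t \<open>0 < e\<close>
    by (cases s t rule: linorder_cases) (auto simp: dist_real_def dist_commute)
  then show "\<exists>d>0. \<forall>s\<in>{0..b}. dist s t < d \<longrightarrow> dist (T s x) (T t x) < e"
    using d(1) by blast
qed

section \<open>Integrals of orbits and density of the domains\<close>

lemma semigroup_integral_right_derivative:
  fixes T :: "real \<Rightarrow> 'a::complex_hilbert \<Rightarrow> 'a"
  assumes "m_isometric_semigroup m T" "0 \<le> r"
  shows "((\<lambda>u. integral {0..u} (\<lambda>s. T s x)) has_vector_derivative T r x) (at r within {r..})"
proof -
  \<comment> \<open>The endpoint \<open>r + 1\<close> leaves room to the right of \<open>r\<close>,
    also when \<open>r = 0\<close>.\<close>
  have "((\<lambda>u. integral {0..u} (\<lambda>s. T s x)) has_vector_derivative T r x) (at r within {0..r + 1})"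
    using assms by (intro integral_has_vector_derivative semigroup_continuous_on) auto
  then have "((\<lambda>u. integral {0..u} (\<lambda>s. T s x)) has_vector_derivative T r x) (at r within {r..r + 1})"
    by (rule has_vector_derivative_within_subset) (use assms(2) in auto)
  then show ?thesis
    by (simp add: at_within_Icc_at_right at_within_atLeast)
qed

lemma generator_integral:
  fixes T :: "real \<Rightarrow> 'a::complex_hilbert \<Rightarrow> 'a"
  assumes "m_isometric_semigroup m T" "0 \<le> r"
  shows "integral {0..r} (\<lambda>s. T s x) \<in> generator_domain T"
    and "generator T (integral {0..r} (\<lambda>s. T s x)) = T r x - x"
proof -
  have C0: "C0_semigroup T"
    using assms by (simp add: m_isometric_semigroup_def)
  define F where "F u = integral {0..u} (\<lambda>s. T s x)" for u
  have F0: "F 0 = 0"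
    by (simp add: F_def)
  have shift: "T h (F r) = F (r + h) - F h" if "0 < h" for h
  proof -
    have "T h (F r) = integral {0..r} (T h \<circ> (\<lambda>s. T s x))"
      unfolding F_def using that assms
      by (intro integral_linear [symmetric] C0_bounded_linear [OF C0] integrable_continuous_real
          semigroup_continuous_on) simp_all
    also have "\<dots> = integral {0..r} ((\<lambda>s. T s x) \<circ> (+) h)"
      using that by (intro integral_cong) (simp add: C0_add [OF C0])
    also have "\<dots> = integral {h..r + h} (\<lambda>s. T s x)"
      by (simp add: integral_shift_Icc_real)
    finally show ?thesis
      using Henstock_Kurzweil_Integration.integral_combine [where a = 0 and c = h and b = "r + h" and f = "\<lambda>s. T s x"] that assms(2)
        integrable_continuous_real [OF semigroup_continuous_on [OF assms(1)]]
      by (simp add: F_def algebra_simps)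
  qed
  \<comment> \<open>By \<open>shift\<close>, the generator's difference quotient at
    \<open>F r\<close> is the difference of the right difference quotients of \<open>F\<close> at
    \<open>r\<close> and at 0.\<close>
  have "((\<lambda>h. (F (r + h) - F r) /\<^sub>R h - (F (0 + h) - F 0) /\<^sub>R h) \<longlongrightarrow> T r x - T 0 x) (at_right 0)"
    using assms semigroup_integral_right_derivative [of m T]
    by (intro tendsto_diff) (simp_all only: F_def has_vector_derivative_right_iff order_refl)
  then have "((\<lambda>h. (T h (F r) - F r) /\<^sub>R h) \<longlongrightarrow> T r x - x) (at_right 0)"
    unfolding C0_zero [OF C0]
    by (rule Lim_transform_eventually)
      (auto intro!: eventually_at_rightI [of 0 1] simp: shift F0 algebra_simps)
  then show "integral {0..r} (\<lambda>s. T s x) \<in> generator_domain T"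
    "generator T (integral {0..r} (\<lambda>s. T s x)) = T r x - x"
    unfolding F_def by (rule generatorI [OF C0])+
qed

lemma csubspace_scaleR: "csubspace D \<Longrightarrow> x \<in> D \<Longrightarrow> r *\<^sub>R x \<in> D"
  unfolding csubspace_def by (metis scaleC_of_real)

lemma csubspace_diff: "csubspace D \<Longrightarrow> x \<in> D \<Longrightarrow> y \<in> D \<Longrightarrow> x - y \<in> D"
  using csubspace_scaleR [of D y "- 1"] unfolding csubspace_def by force

lemma closure_domain_power:
  fixes T :: "real \<Rightarrow> 'a::complex_hilbert \<Rightarrow> 'a"
  assumes "m_isometric_semigroup m T"
  shows "closure (domain_power (generator_domain T) (generator T) n) = UNIV"
proof (induction n)
  case (Suc n)
  have C0: "C0_semigroup T"
    using assms by (simp add: m_isometric_semigroup_def)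
  let ?D = "domain_power (generator_domain T) (generator T)"
  have "x \<in> closure (?D (Suc n))" if x: "x \<in> ?D n" for x
  proof -
    define F where "F u = integral {0..u} (\<lambda>s. T s x)" for u
    \<comment> \<open>Integration gains one power: the generator sends \<open>F r\<close> to
      \<open>T r x - x\<close>, which stays in the invariant subspace \<open>?D n\<close>.\<close>
    have "F r \<in> ?D (Suc n)" if "0 < r" for r
      using that generator_integral [OF assms] x csubspace_domain_power [OF C0]
      by (auto simp: F_def intro!: csubspace_diff domain_power_semigroup [OF C0])
    then have "\<forall>\<^sub>F r in at_right 0. F r /\<^sub>R r \<in> closure (?D (Suc n))"
      by (intro eventually_at_rightI [of 0 1] subsetD [OF closure_subset]
          csubspace_scaleR csubspace_domain_power [OF C0]) simp_all
    moreover have "((\<lambda>r. F r /\<^sub>R r) \<longlongrightarrow> x) (at_right 0)"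
      using semigroup_integral_right_derivative [OF assms, of 0 x]
      by (simp add: has_vector_derivative_right_iff F_def C0_zero [OF C0])
    ultimately show ?thesis
      by (intro Lim_in_closed_set [of "closure (?D (Suc n))"]) simp_all
  qed
  then have "closure (?D n) \<subseteq> closure (?D (Suc n))"
    by (intro closure_minimal) auto
  then show ?case
    using Suc by blast
qed simp

section \<open>The coefficient forms\<close>

text \<open>The factor \<open>fact j\<close> turns the coefficient of \<open>t ^ j\<close> into the
  \<open>j\<close>-th derivative at 0. The form is given in two arguments because a quadratic form
  has to come from a sesquilinear one.\<close>

definition coefficient_form ::
    "(real \<Rightarrow> 'a::complex_inner \<Rightarrow> 'a) \<Rightarrow> nat \<Rightarrow> nat \<Rightarrow> 'a \<Rightarrow> 'a \<Rightarrow> complex" where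
  "coefficient_form T m j x y =
     (\<Sum>k<m. complex_of_real (fact j * coeff (interpolation_basis m k) j) *
        cinner (T (real k) x) (T (real k) y))"

lemma coefficient_form_diag:
  "coefficient_form T m j x x =
     complex_of_real (fact j * coeff (interpolation_poly m (\<lambda>k. (norm (T (real k) x))\<^sup>2)) j)"
  by (simp add: coefficient_form_def interpolation_poly_def cinner_self coeff_sum
      sum_distrib_left mult_ac)

lemma sesquilinear_coefficient_form:
  assumes "C0_semigroup T"
  shows "sesquilinear_on D (coefficient_form T m j)"
proof -
  have "bounded_clinear (T (real k))" for k
    by (intro C0_bounded_clinear [OF assms]) simp
  then have "T (real k) (x + y) = T (real k) x + T (real k) y"
    "T (real k) (c *\<^sub>C x) = c *\<^sub>C T (real k) x" for k c x y
    by (auto simp: bounded_clinear_def linear_add bounded_linear.linear)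
  then show ?thesis
    by (simp add: sesquilinear_on_def coefficient_form_def cinner_add_left cinner_add_right
        cinner_scaleC_left cinner_scaleC_right sum.distrib sum_distrib_left distrib_left mult_ac)
qed

lemma coefficient_form_bounded:
  assumes "C0_semigroup T"
  shows "\<exists>C. \<forall>x. cmod (coefficient_form T m j x x) \<le> C * (norm x)\<^sup>2"
proof -
  define w where "w k = fact j * coeff (interpolation_basis m k) j" for k
  have "cmod (coefficient_form T m j x x) \<le> (\<Sum>k<m. \<bar>w k\<bar> * (onorm (T (real k)))\<^sup>2) * (norm x)\<^sup>2"
    for x
  proof -
    have "norm (T (real k) x) \<le> onorm (T (real k)) * norm x" for k
      by (intro onorm C0_bounded_linear [OF assms]) simp
    then have "(norm (T (real k) x))\<^sup>2 \<le> (onorm (T (real k)))\<^sup>2 * (norm x)\<^sup>2" for k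
      by (metis norm_ge_zero power_mono power_mult_distrib)
    then show ?thesis
      unfolding coefficient_form_def sum_distrib_right w_def [symmetric]
      by (intro sum_norm_le)
        (auto simp: cinner_self norm_mult norm_power mult.assoc intro!: mult_left_mono)
  qed
  then show ?thesis
    by blast
qed

lemma continuous_coefficient_form:
  assumes "C0_semigroup T"
  shows "continuous_on S (\<lambda>x. coefficient_form T m j x x)"
  unfolding coefficient_form_def cinner_self
  by (intro continuous_intros linear_continuous_on C0_bounded_linear [OF assms]) simp

lemma bounded_form_onI:
  assumes "csubspace D" "C0_semigroup T" "\<And>y. y \<in> D \<Longrightarrow> q y = coefficient_form T m j y y"
  shows "bounded_form_on D q"
  using assms coefficient_form_bounded [OF assms(2), of m j]
    sesquilinear_coefficient_form [OF assms(2), of D m j]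
  by (auto simp: bounded_form_on_def quadratic_form_on_def)

lemma norm_semigroup_coefficient_form:
  assumes "1 \<le> m" "m_isometric_semigroup m T" "0 \<le> t"
  shows "complex_of_real ((norm (T t x))\<^sup>2) =
    (\<Sum>j=0..m-1. complex_of_real (t ^ j / fact j) * coefficient_form T m j x x)"
proof -
  define p where "p = interpolation_poly m (\<lambda>k. (norm (T (real k) x))\<^sup>2)"
  have "degree p \<le> m - 1"
    using assms(1) by (intro degree_le) (auto simp: p_def coeff_interpolation_poly_eq_0)
  then have "poly p t = (\<Sum>j=0..m-1. coeff p j * t ^ j)"
    by (subst poly_as_sum_of_monoms' [symmetric])
      (simp_all add: poly_sum poly_monom atMost_atLeast0)
  also have "\<dots> = (\<Sum>j=0..m-1. t ^ j / fact j * (fact j * coeff p j))"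
    by (simp add: mult.commute)
  finally show ?thesis
    unfolding semigroup_norm_poly [OF assms(2,3)] coefficient_form_diag p_def [symmetric]
    by simp
qed

text \<open>Differentiate along the whole orbit: with the identity known for all
  \<open>t \<ge> 0\<close>, taking right derivatives of both sides raises \<open>n\<close> by one,
  and Pascal's rule collects the product-rule terms.\<close>

lemma higher_pderiv_norm_semigroup:
  assumes C0: "C0_semigroup T"
    and p: "\<And>t. 0 \<le> t \<Longrightarrow> (norm (T t y))\<^sup>2 = poly p t"
    and "y \<in> domain_power (generator_domain T) (generator T) n" "0 \<le> t"
  shows "(\<Sum>i=0..n. of_nat (n choose i) *
      cinner (T t ((generator T ^^ i) y)) (T t ((generator T ^^ (n - i)) y)))
    = complex_of_real (poly ((pderiv ^^ n) p) t)"
  using assms(3,4)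
proof (induction n arbitrary: t)
  case 0
  then show ?case
    by (simp add: cinner_self p [symmetric])
next
  case (Suc n)
  let ?A = "generator T"
  define G where "G i k s = cinner (T s ((?A ^^ i) y)) (T s ((?A ^^ k) y))" for i k s
  have "((\<lambda>s. T s ((?A ^^ i) y)) has_vector_derivative T t ((?A ^^ Suc i) y)) (at t within {t..})"
    if "i \<le> n" for i
    using semigroup_right_derivative [OF C0 funpow_in_domain [OF Suc.prems(1)] Suc.prems(2)] that
    by simp
  then have G: "(G i k has_vector_derivative (G i (Suc k) t + G (Suc i) k t)) (at t within {t..})"
    if "i \<le> n" "k \<le> n" for i k
    using that unfolding G_def
    by (intro bounded_bilinear.has_vector_derivative [OF bounded_bilinear_cinner])
  have "((\<lambda>s. \<Sum>i=0..n. of_nat (n choose i) * G i (n - i) s) has_vector_derivative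
      (\<Sum>i=0..n. of_nat (n choose i) * (G i (Suc (n - i)) t + G (Suc i) (n - i) t)))
      (at t within {t..})"
    by (intro has_vector_derivative_sum has_vector_derivative_mult_right G) auto
  also have "(\<Sum>i=0..n. of_nat (n choose i) * (G i (Suc (n - i)) t + G (Suc i) (n - i) t))
      = (\<Sum>i=0..Suc n. of_nat (Suc n choose i) * G i (Suc n - i) t)"
    unfolding sum_choose_Suc by (intro sum.cong) (simp_all add: Suc_diff_le)
  finally have "((\<lambda>s. complex_of_real (poly ((pderiv ^^ n) p) s)) has_vector_derivative
      (\<Sum>i=0..Suc n. of_nat (Suc n choose i) * G i (Suc n - i) t)) (at t within {t..})"
    using Suc.IH [OF domain_power_mono [OF Suc.prems(1)]] Suc.prems(2)
    by (intro has_vector_derivative_transform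
        [of t _ "\<lambda>s. complex_of_real (poly ((pderiv ^^ n) p) s)"]) (auto simp: G_def)
  moreover have "((\<lambda>s. complex_of_real (poly ((pderiv ^^ n) p) s)) has_vector_derivative
      complex_of_real (poly ((pderiv ^^ Suc n) p) t)) (at t within {t..})"
    by (intro has_vector_derivative_of_real)
      (simp add: DERIV_subset [OF poly_DERIV])
  \<comment> \<open>Both values are right derivatives of the same function at \<open>t\<close>, and
    these are unique.\<close>
  ultimately show ?case
    unfolding G_def
    by (intro vector_derivative_unique_within [of t "{t..}"]) (simp_all add: at_within_atLeast)
qed

text \<open>The derivative formula at time 0, where \<open>T 0\<close> is the identity and the
  \<open>n\<close>-th derivative of a polynomial is \<open>fact n\<close> times its
  coefficient.\<close>

lemma alpha_eq_coefficient_form: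
  assumes "m_isometric_semigroup m T"
    and "y \<in> domain_power (generator_domain T) (generator T) n"
  shows "alpha (generator T) n y = coefficient_form T m n y y"
proof -
  have C0: "C0_semigroup T"
    using assms by (simp add: m_isometric_semigroup_def)
  show ?thesis
    using higher_pderiv_norm_semigroup [OF C0 semigroup_norm_poly [OF assms(1)] assms(2), of 0]
    by (simp add: alpha_def coefficient_form_diag C0_zero [OF C0] poly_0_coeff_0
        coeff_higher_pderiv pochhammer_fact)
qed

text \<open>Evaluates the description: continuous functions that agree on a dense set are
  equal.\<close>

lemma bounded_extension_eqI:
  assumes "closure D = UNIV" "bounded_form_on UNIV Q" "continuous_on UNIV Q"
    and "\<And>y. y \<in> D \<Longrightarrow> Q y = q y"
  shows "bounded_extension D q = Q"
  unfolding bounded_extension_def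
proof (rule the_equality)
  fix R
  assume R: "bounded_form_on UNIV R \<and> continuous_on UNIV R \<and> (\<forall>y\<in>D. R y = q y)"
  have "R x - Q x = 0" for x
    by (rule continuous_constant_on_closure [of D "\<lambda>x. R x - Q x"])
      (use R assms in \<open>auto intro!: continuous_intros\<close>)
  then show "R = Q"
    by auto
qed (use assms in auto)

theorem theorem3p3:
  fixes T :: "real \<Rightarrow> 'a::complex_hilbert \<Rightarrow> 'a"
    and A :: "'a \<Rightarrow> 'a"
    and D :: "nat \<Rightarrow> 'a set"
    and m :: nat
  assumes "m \<ge> 1"
    and "m_isometric_semigroup m T"
    and "A = generator T"
    and "\<And>j. D j = domain_power (generator_domain T) A j"
  shows "(\<forall>j<m. closure (D j) = UNIV \<and> bounded_form_on (D j) (alpha A j)) \<and>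
         (\<forall>x. \<forall>t\<ge>0. complex_of_real ((norm (T t x))\<^sup>2) =
           (\<Sum>j=0..m-1. complex_of_real (t ^ j / fact j) *
              bounded_extension (D j) (alpha A j) x))"
proof -
  have C0: "C0_semigroup T"
    using assms(2) by (simp add: m_isometric_semigroup_def)
  have D: "D j = domain_power (generator_domain T) (generator T) j" for j
    using assms(3,4) by simp
  have dense: "closure (D j) = UNIV" for j
    unfolding D by (rule closure_domain_power [OF assms(2)])
  have alpha: "alpha A j y = coefficient_form T m j y y" if "y \<in> D j" for j y
    using alpha_eq_coefficient_form [OF assms(2)] that by (simp add: D assms(3))
  have "bounded_form_on (D j) (alpha A j)" for j
    using csubspace_domain_power [OF C0] C0 alpha by (intro bounded_form_onI) (simp_all add: D)
  moreover have "bounded_form_on UNIV (\<lambda>x. coefficient_form T m j x x)" for j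
    by (rule bounded_form_onI [OF _ C0]) (auto simp: csubspace_def)
  \<comment> \<open>The coefficient form is defined everywhere, so it is itself the extension, and
    the polynomial formula in its terms gives the claim.\<close>
  then have "bounded_extension (D j) (alpha A j) = (\<lambda>x. coefficient_form T m j x x)" for j
    using dense alpha continuous_coefficient_form [OF C0] by (intro bounded_extension_eqI) simp_all
  ultimately show ?thesis
    using dense norm_semigroup_coefficient_form [OF assms(1,2)] by simp
qed

end
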